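(* Let $\Gamma=1$ and let $G=(V,A,s,t,u)$ be a directed acyclic graph. Then $f^*_{gm}\le 2f^*_{pm}$ and $f^*_{am}\le 2f^*_{pm}$, where $f^*_{pm}$, $f^*_{am}$, $f^*_{gm}$ are the optimal values of the path model (PM), the arc model (AM) and the general model (GM), respectively.
   Context: $\mathbb{N}=\{1,2,\dots\}$. $G=(V,A,s,t,u)$ is a finite directed graph (parallel arcs allowed) with two distinct nodes, source $s$ and sink $t$, and capacities $u_a\in\mathbb{N}$ for $a\in A$. The source $s$ has no incoming arcs, $t$ has no outgoing arcs, and for every $v\in V\setminus\{s,t\}$ there is a directed $s$-$v$-$t$-path. $\delta_A^-(v)$, $\delta_A^+(v)$ are the sets of incoming and outgoing arcs of $v$. For $\Gamma\in\mathbb{N}$ let $\mathcal{S}=\{S\subseteq A: |S|\le\Gamma\}$ and $\Lambda=\{z\in\{0,1\}^{|A|}:\sum_{a\in A}z(a)\le\Gamma\}$. $\mathcal{P}$ is the set of all simple $s$-$t$-paths, and $\bar{\mathcal{P}}$ is the set of all directed $v$-$w$-paths $P$ ($v,w\in V$, at least one arc) that are subpaths of some path in $\mathcal{P}$; paths are identified with their arc sets. $\delta_{\bar{\mathcal{P}}}^-(v)$ and $\delta_{\bar{\mathcal{P}}}^+(v)$ are the sets of paths in $\bar{\mathcal{P}}$ ending at $v$ and starting at $v$. Path model (PM): $f^*_{pm}=\max_{x\in\mathbb{R}_{\ge0}^{|\mathcal{P}|}}\sum_{P\in\mathcal{P}}x(P)-\max_{S\in\mathcal{S}}\sum_{P\in\mathcal{P}:P\cap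 S\ne\emptyset}x(P)$ subject to $\sum_{P\in\mathcal{P}:a\in P}x(P)\le u_a$ for all $a\in A$. Arc model (AM): $f^*_{am}=\max_{x\in\mathbb{R}_{\ge0}^{|A|}}\sum_{a\in\delta_A^-(t)}x(a)-\max_{z\in\Lambda}\sum_{a\in\delta_A^-(t)}z(a)x(a)$ subject to $\sum_{a\in\delta_A^-(v)}(1-z(a))x(a)-\sum_{a\in\delta_A^+(v)}x(a)\ge0$ for all $v\in V\setminus\{s,t\}$, $z\in\Lambda$, and $x(a)\le u_a$ for all $a\in A$. General model (GM): $f^*_{gm}=\max_{x\in\mathbb{R}^{|\bar{\mathcal{P}}|}_{\ge0}}\sum_{P\in\delta_{\bar{\mathcal{P}}}^-(t)}x(P)-\max_{S\in\mathcal{S}}\sum_{P\in\delta_{\bar{\mathcal{P}}}^-(t):P\cap S\ne\emptyset}x(P)$ subject to $\sum_{P\in\delta_{\bar{\mathcal{P}}}^-(v)}x(P)-\sum_{P\in\delta_{\bar{\mathcal{P}}}^-(v):P\cap S\neq\emptyset}x(P)\ge\sum_{P\in\delta_{\bar{\mathcal{P}}}^+(v)}x(P)$ for all $v\in V\setminus\{s,t\}$, $S\in\mathcal{S}$, and $\sum_{P\in\bar{\mathcal{P}}:a\in P}x(P)\le u_a$ for all $a\in A$. *)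

theory Defs
  imports
    Complex_Main
    "HOL-Library.FuncSet"
    "HOL-Library.Sublist"
    "Graph_Theory.Arc_Walk"
begin

text \<open>
  Digraphs, arc walks and simple paths (\<open>apath\<close>) come from the AFP entry
  \<open>Graph_Theory\<close>; parallel arcs are allowed there. A path is represented by the
  list of its arcs, so that the arc set of a path \<open>P\<close> is \<open>set P\<close>. The space
  \<open>\<real>\<^sub>\<ge>\<^sub>0\<close> to the power \<open>|I|\<close> is rendered as \<open>I \<rightarrow>\<^sub>E {0..}\<close>.
\<close>

locale network = fin_digraph G
  for G :: "('a, 'b) pre_digraph" (structure) +
  fixes s t :: 'a and u :: "'b \<Rightarrow> nat"
  assumes source_in_verts: "s \<in> verts G"
    and sink_in_verts: "t \<in> verts G"
    and source_neq_sink: "s \<noteq> t"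
    and capacity_pos: "a \<in> arcs G \<Longrightarrow> 0 < u a"
    and no_arc_into_source: "in_arcs G s = {}"
    and no_arc_out_of_sink: "out_arcs G t = {}"
    and on_st_path: "v \<in> verts G - {s, t} \<Longrightarrow> \<exists>p. apath s p t \<and> v \<in> set (awalk_verts s p)"
begin

definition interdictions :: "nat \<Rightarrow> 'b set set" where
  "interdictions \<Gamma> = {S. S \<subseteq> arcs G \<and> card S \<le> \<Gamma>}"

definition interdiction_vecs :: "nat \<Rightarrow> ('b \<Rightarrow> real) set" where
  "interdiction_vecs \<Gamma> = {z \<in> arcs G \<rightarrow>\<^sub>E {0, 1}. (\<Sum>a\<in>arcs G. z a) \<le> real \<Gamma>}"

definition st_paths :: "'b awalk set" where
  "st_paths = {P. apath s P t}"

definition subpaths :: "'b awalk set" where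
  "subpaths = {Q. Q \<noteq> [] \<and> (\<exists>P\<in>st_paths. sublist Q P)}"

definition in_subpaths :: "'a \<Rightarrow> 'b awalk set" where
  "in_subpaths v = {Q \<in> subpaths. \<exists>w. apath w Q v}"

definition out_subpaths :: "'a \<Rightarrow> 'b awalk set" where
  "out_subpaths v = {Q \<in> subpaths. \<exists>w. apath v Q w}"

definition pm_feasible :: "('b awalk \<Rightarrow> real) set" where
  "pm_feasible = {x \<in> st_paths \<rightarrow>\<^sub>E {0..}.
     \<forall>a\<in>arcs G. (\<Sum>P | P \<in> st_paths \<and> a \<in> set P. x P) \<le> real (u a)}"

definition pm_objective :: "nat \<Rightarrow> ('b awalk \<Rightarrow> real) \<Rightarrow> real" where
  "pm_objective \<Gamma> x = (\<Sum>P\<in>st_paths. x P) -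
     Max ((\<lambda>S. \<Sum>P | P \<in> st_paths \<and> set P \<inter> S \<noteq> {}. x P) ` interdictions \<Gamma>)"

definition am_feasible :: "nat \<Rightarrow> ('b \<Rightarrow> real) set" where
  "am_feasible \<Gamma> = {x \<in> arcs G \<rightarrow>\<^sub>E {0..}.
     (\<forall>v\<in>verts G - {s, t}. \<forall>z\<in>interdiction_vecs \<Gamma>.
        (\<Sum>a\<in>in_arcs G v. (1 - z a) * x a) - (\<Sum>a\<in>out_arcs G v. x a) \<ge> 0) \<and>
     (\<forall>a\<in>arcs G. x a \<le> real (u a))}"

definition am_objective :: "nat \<Rightarrow> ('b \<Rightarrow> real) \<Rightarrow> real" where
  "am_objective \<Gamma> x = (\<Sum>a\<in>in_arcs G t. x a) -
     Max ((\<lambda>z. \<Sum>a\<in>in_arcs G t. z a * x a) ` interdiction_vecs \<Gamma>)"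

definition gm_feasible :: "nat \<Rightarrow> ('b awalk \<Rightarrow> real) set" where
  "gm_feasible \<Gamma> = {x \<in> subpaths \<rightarrow>\<^sub>E {0..}.
     (\<forall>v\<in>verts G - {s, t}. \<forall>S\<in>interdictions \<Gamma>.
        (\<Sum>P\<in>in_subpaths v. x P) - (\<Sum>P | P \<in> in_subpaths v \<and> set P \<inter> S \<noteq> {}. x P)
          \<ge> (\<Sum>P\<in>out_subpaths v. x P)) \<and>
     (\<forall>a\<in>arcs G. (\<Sum>P | P \<in> subpaths \<and> a \<in> set P. x P) \<le> real (u a))}"

definition gm_objective :: "nat \<Rightarrow> ('b awalk \<Rightarrow> real) \<Rightarrow> real" where
  "gm_objective \<Gamma> x = (\<Sum>P\<in>in_subpaths t. x P) -
     Max ((\<lambda>S. \<Sum>P | P \<in> in_subpaths t \<and> set P \<inter> S \<noteq> {}. x P) ` interdictions \<Gamma>)"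

text \<open>
  The optimal values are maxima, not mere suprema: \<open>GREATEST\<close> is specified only if the
  maximum is attained, which holds since each feasible set is compact and nonempty.
\<close>

definition pm_opt :: "nat \<Rightarrow> real" where
  "pm_opt \<Gamma> = (GREATEST r. r \<in> pm_objective \<Gamma> ` pm_feasible)"

definition am_opt :: "nat \<Rightarrow> real" where
  "am_opt \<Gamma> = (GREATEST r. r \<in> am_objective \<Gamma> ` am_feasible \<Gamma>)"

definition gm_opt :: "nat \<Rightarrow> real" where
  "gm_opt \<Gamma> = (GREATEST r. r \<in> gm_objective \<Gamma> ` gm_feasible \<Gamma>)"

end

end

theory Submission
  imports Defs "HOL-Analysis.Function_Topology"
begin

text \<open>
  Let \<open>R\<close> be the value of a feasible solution of the general model or of the arc model, and let
  \<open>S\<close> be a scenario. Discarding what \<open>S\<close> destroys and adding up the conservation constraints of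
  that scenario over the sink side of an \<open>s\<close>-\<open>t\<close>-cut shows that the arcs of the cut outside \<open>S\<close> still
  have total capacity at least \<open>R\<close>. For \<open>\<Gamma> = 1\<close> it follows that after truncating all capacities at
  \<open>R / 2\<close> every cut retains capacity at least \<open>R\<close>: either two of its arcs have capacity at least
  \<open>R / 2\<close>, or removing the only one that might be truncated leaves at least \<open>R\<close>. By max-flow min-cut
  and path decomposition there is a path flow of value at least \<open>R\<close> with at most \<open>R / 2\<close> on each arc,
  so interdicting one arc leaves at least \<open>R / 2\<close>.
\<close>

section \<open>Attainment of maxima over function spaces\<close>

lemma closed_PiE_atLeast: "closed (I \<rightarrow>\<^sub>E {c..} :: ('i \<Rightarrow> real) set)"
proof -
  have "I \<rightarrow>\<^sub>E {c..} = (\<Inter>i\<in>I. {x. c \<le> x i}) \<inter> (\<Inter>i\<in>-I. {x :: 'i \<Rightarrow> real. x i = undefined})"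
    by (auto simp: PiE_def Pi_def extensional_def)
  then show ?thesis
    by (auto intro!: closed_Int closed_INT closed_Collect_le closed_Collect_eq
        continuous_on_product_coordinates)
qed

text \<open>Tychonoff: extensional functions form a full product once every coordinate outside
  \<open>I\<close> gets the singleton factor \<open>{undefined}\<close>.\<close>

lemma compact_PiE_atLeastAtMost: "compact (I \<rightarrow>\<^sub>E {a..b} :: ('i \<Rightarrow> real) set)"
proof -
  have "I \<rightarrow>\<^sub>E {a..b} = (\<Pi>\<^sub>E i\<in>UNIV. if i \<in> I then {a..b} else {undefined :: real})"
    by (auto simp: PiE_def Pi_def extensional_def split: if_splits)
  moreover have "compactin (product_topology (\<lambda>i. euclidean) UNIV)
      (\<Pi>\<^sub>E i\<in>UNIV. if i \<in> I then {a..b} else {undefined :: real})"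
    by (subst compactin_PiE) auto
  ultimately show ?thesis
    by (simp add: euclidean_product_topology flip: compactin_euclidean_iff)
qed

lemma continuous_on_Max_image:
  fixes g :: "'k \<Rightarrow> 'x::topological_space \<Rightarrow> real"
  assumes "finite K" "K \<noteq> {}" "\<And>k. k \<in> K \<Longrightarrow> continuous_on A (g k)"
  shows "continuous_on A (\<lambda>x. Max ((\<lambda>k. g k x) ` K))"
  using assms
proof (induction rule: finite_ne_induct)
  case (insert k K)
  then show ?case
    by (auto intro!: continuous_on_max)
qed simp

text \<open>Makes \<open>GREATEST\<close> usable: a closed subset of a compact box is compact, so
  the continuous objective attains its supremum there. Serves the three models and also yields a
  maximum flow.\<close>

lemma Greatest_attained:
  fixes F :: "('i \<Rightarrow> real) set" and obj :: "('i \<Rightarrow> real) \<Rightarrow> real"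
  assumes "closed F" "F \<subseteq> I \<rightarrow>\<^sub>E {a..b}" "F \<noteq> {}" "continuous_on UNIV obj"
  obtains x where "x \<in> F" "(GREATEST r. r \<in> obj ` F) = obj x" "\<And>y. y \<in> F \<Longrightarrow> obj y \<le> obj x"
proof -
  have "compact ((I \<rightarrow>\<^sub>E {a..b}) \<inter> F)"
    by (intro compact_Int_closed compact_PiE_atLeastAtMost assms(1))
  then have "compact F"
    using assms(2) by (simp add: Int_absorb1)
  then obtain x where x: "x \<in> F" "\<And>y. y \<in> F \<Longrightarrow> obj y \<le> obj x"
    using continuous_attains_sup[of F obj] assms(3,4) continuous_on_subset by blast
  moreover have "(GREATEST r. r \<in> obj ` F) = obj x"
    by (rule Greatest_equality) (use x in auto)
  ultimately show thesis
    using that by blast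
qed

section \<open>Flows and cuts\<close>

text \<open>Items with both ends in \<open>W\<close> cancel, leaving those that cross its boundary.
  The index set and the end maps \<open>h\<close>, \<open>l\<close> are abstract so that items can
  be arcs or whole paths.\<close>

lemma sum_balance_eq_cut:
  fixes y :: "'j \<Rightarrow> real" and h l :: "'j \<Rightarrow> 'v"
  assumes "finite J" "finite W"
  shows "(\<Sum>v\<in>W. (\<Sum>j | j \<in> J \<and> h j = v. y j) - (\<Sum>j | j \<in> J \<and> l j = v. y j)) =
    (\<Sum>j | j \<in> J \<and> h j \<in> W \<and> l j \<notin> W. y j) - (\<Sum>j | j \<in> J \<and> h j \<notin> W \<and> l j \<in> W. y j)"
proof -
  \<comment> \<open>Treats both orientations at once. The sum over items inside \<open>W\<close> has
    the same form for \<open>h\<close> and \<open>l\<close>, so it disappears on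
    subtraction.\<close>
  have *: "(\<Sum>v\<in>W. \<Sum>j | j \<in> J \<and> k j = v. y j) =
      (\<Sum>j | j \<in> J \<and> h j \<in> W \<and> l j \<in> W. y j) + (\<Sum>j | j \<in> J \<and> k j \<in> W \<and> k' j \<notin> W. y j)"
    if "k = h \<and> k' = l \<or> k = l \<and> k' = h" for k k' :: "'j \<Rightarrow> 'v"
  proof -
    have "(\<Sum>v\<in>W. \<Sum>j | j \<in> J \<and> k j = v. y j) = (\<Sum>v\<in>W. \<Sum>j | j \<in> {j \<in> J. k j \<in> W} \<and> k j = v. y j)"
      by (intro sum.cong refl) auto
    also have "\<dots> = (\<Sum>j | j \<in> J \<and> k j \<in> W. y j)"
      by (rule sum.group) (use assms in auto)
    also have "{j. j \<in> J \<and> k j \<in> W} =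
        {j. j \<in> J \<and> h j \<in> W \<and> l j \<in> W} \<union> {j. j \<in> J \<and> k j \<in> W \<and> k' j \<notin> W}"
      using that by auto
    finally show ?thesis
      by (subst (asm) sum.union_disjoint) (use assms that in auto)
  qed
  show ?thesis
    using *[of h l] *[of l h] by (simp add: sum_subtractf conj_commute)
qed

section \<open>Net inflow of arc functions and its value across cuts\<close>

context fin_digraph
begin

definition excess :: "('b \<Rightarrow> real) \<Rightarrow> 'a \<Rightarrow> real" where
  "excess f v = (\<Sum>a\<in>in_arcs G v. f a) - (\<Sum>a\<in>out_arcs G v. f a)"

lemma excess_cong: "(\<And>a. a \<in> arcs G \<Longrightarrow> f a = g a) \<Longrightarrow> excess f v = excess g v"
  unfolding excess_def by (intro arg_cong2[where f = "(-)"] sum.cong) auto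

lemma excess_add: "excess (\<lambda>a. f a + g a) v = excess f v + excess g v"
  by (simp add: excess_def sum.distrib)

lemma excess_scale: "excess (\<lambda>a. r * f a) v = r * excess f v"
  by (simp add: excess_def right_diff_distrib sum_distrib_left)

lemma excess_single:
  assumes "a \<in> arcs G"
  shows "excess (\<lambda>b. of_bool (b = a)) v = of_bool (v = head G a) - of_bool (v = tail G a)"
proof -
  have "(\<Sum>b\<in>A. of_bool (b = a)) = (of_bool (a \<in> A) :: real)" if "finite A" for A :: "'b set"
    using that by (simp add: of_bool_def)
  then show ?thesis
    using assms by (auto simp: excess_def finite_in_arcs finite_out_arcs)
qed

text \<open>The contributions of consecutive arcs telescope. Simplicity makes the first arc differ
  from all later ones, so the indicator of the arc set splits into a sum.\<close>

lemma excess_apath: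
  assumes "apath v p w"
  shows "excess (\<lambda>a. of_bool (a \<in> set p)) z = of_bool (z = w) - of_bool (z = v)"
  using assms
proof (induction p arbitrary: v)
  case Nil
  then show ?case by (auto simp: excess_def apath_simps)
next
  case (Cons a p)
  from Cons.prems have a: "a \<in> arcs G" "tail G a = v" "apath (head G a) p w" "a \<notin> set p"
    using awalk_verts_arc1 by (auto simp: apath_Cons_iff)
  have "excess (\<lambda>b. of_bool (b \<in> set (a # p))) z =
      excess (\<lambda>b. of_bool (b = a) + of_bool (b \<in> set p)) z"
    using a(4) by (intro excess_cong) auto
  also have "\<dots> = of_bool (z = w) - of_bool (z = v)"
    using a by (simp add: excess_add excess_single Cons.IH)
  finally show ?case .
qed

lemma sum_excess_eq_cut:
  assumes "W \<subseteq> verts G"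
  shows "(\<Sum>v\<in>W. excess f v) =
    (\<Sum>a | a \<in> arcs G \<and> head G a \<in> W \<and> tail G a \<notin> W. f a) -
    (\<Sum>a | a \<in> arcs G \<and> head G a \<notin> W \<and> tail G a \<in> W. f a)"
  using sum_balance_eq_cut[of "arcs G" W f "head G" "tail G"] assms finite_subset[OF assms]
  by (simp add: excess_def in_arcs_def out_arcs_def)

text \<open>As \<open>s\<close> lies outside \<open>W\<close>, the sink is the only node of
  \<open>W\<close> whose excess can be nonzero.\<close>

lemma excess_sink_eq_cut:
  assumes "W \<subseteq> verts G" "t \<in> W" "s \<notin> W" "\<And>v. v \<in> verts G - {s, t} \<Longrightarrow> excess f v = 0"
  shows "excess f t = (\<Sum>a | a \<in> arcs G \<and> head G a \<in> W \<and> tail G a \<notin> W. f a) -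
    (\<Sum>a | a \<in> arcs G \<and> head G a \<notin> W \<and> tail G a \<in> W. f a)"
proof -
  have "(\<Sum>v\<in>W. excess f v) = (\<Sum>v\<in>{t}. excess f v)"
    using assms finite_subset[OF assms(1)] by (intro sum.mono_neutral_right) auto
  then show ?thesis
    using sum_excess_eq_cut[OF assms(1)] by simp
qed

section \<open>Residual reachability and max-flow min-cut\<close>

definition residual :: "('b \<Rightarrow> real) \<Rightarrow> ('b \<Rightarrow> real) \<Rightarrow> 'a rel" where
  "residual c f = {(tail G a, head G a) | a. a \<in> arcs G \<and> f a < c a} \<union>
     {(head G a, tail G a) | a. a \<in> arcs G \<and> 0 < f a}"

text \<open>Instead of augmenting along a whole residual path, the correction \<open>g\<close> is extended arc by
  arc, scaled down at each step so that it leaves room on the next arc.\<close>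

lemma residual_augment:
  assumes "(s, v) \<in> (residual c f)\<^sup>*" and f: "\<And>a. a \<in> arcs G \<Longrightarrow> 0 \<le> f a \<and> f a \<le> c a"
  shows "\<exists>\<epsilon> g. 0 < \<epsilon> \<and> (\<forall>a\<in>arcs G. 0 \<le> f a + g a \<and> f a + g a \<le> c a) \<and>
    (\<forall>w. excess g w = \<epsilon> * (of_bool (w = v) - of_bool (w = s)))"
  using assms(1)
proof (induction rule: rtrancl_induct)
  case base
  show ?case
    using f by (intro exI[of _ 1] exI[of _ "\<lambda>_. 0"]) (simp add: excess_def)
next
  case (step v w)
  obtain \<epsilon> g where g: "0 < \<epsilon>" "\<And>a. a \<in> arcs G \<Longrightarrow> 0 \<le> f a + g a \<and> f a + g a \<le> c a"
    "\<And>w. excess g w = \<epsilon> * (of_bool (w = v) - of_bool (w = s))"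
    using step.IH by blast
  \<comment> \<open>\<open>\<sigma>\<close> is the residual room on the arc behind the last pair,
    and \<open>d\<close> tells whether that arc is traversed forwards or backwards.\<close>
  obtain a and d \<sigma> :: real where a: "a \<in> arcs G" "0 < \<sigma>"
    and d: "d = 1 \<and> tail G a = v \<and> head G a = w \<and> \<sigma> = c a - f a \<or>
      d = -1 \<and> head G a = v \<and> tail G a = w \<and> \<sigma> = f a"
  proof -
    consider a where "a \<in> arcs G" "f a < c a" "tail G a = v" "head G a = w"
      | a where "a \<in> arcs G" "0 < f a" "head G a = v" "tail G a = w"
      using step.hyps(2) by (auto simp: residual_def)
    then show thesis
      using that[of _ _ 1] that[of _ _ "-1"] by cases auto
  qed
  \<comment> \<open>Chosen so that \<open>\<theta> * \<epsilon> = (1 - \<theta>) * \<sigma>\<close>: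
    the amount pushed over \<open>a\<close> equals the share of its room that scaling
    \<open>g\<close> by \<open>\<theta>\<close> is sure to leave free.\<close>
  define \<theta> where "\<theta> = \<sigma> / (\<sigma> + \<epsilon>)"
  have \<theta>: "0 < \<theta>" "\<theta> \<le> 1" "\<theta> * \<epsilon> = \<sigma> - \<theta> * \<sigma>"
    using a(2) g(1) by (auto simp: \<theta>_def field_simps)
  define g' where "g' = (\<lambda>b. \<theta> * g b + \<theta> * \<epsilon> * d * of_bool (b = a))"
  \<comment> \<open>\<open>f + \<theta> * g\<close> is the convex combination of \<open>f\<close>
    and \<open>f + g\<close>, hence within capacity. The last two bounds say that at least
    \<open>(1 - \<theta>) * \<sigma>\<close> of room remains on \<open>a\<close>, in either
    direction.\<close>
  have conv: "0 \<le> f b + \<theta> * g b \<and> f b + \<theta> * g b \<le> c b \<and>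
      (1 - \<theta>) * f b \<le> f b + \<theta> * g b \<and> f b + \<theta> * g b \<le> (1 - \<theta>) * f b + \<theta> * c b"
    if b: "b \<in> arcs G" for b
  proof -
    have "0 \<le> (1 - \<theta>) * f b" "(1 - \<theta>) * f b \<le> (1 - \<theta>) * c b"
      "0 \<le> \<theta> * (f b + g b)" "\<theta> * (f b + g b) \<le> \<theta> * c b"
      using \<theta> f[OF b] g(2)[OF b] by (auto intro!: mult_left_mono)
    then show ?thesis
      by (simp add: algebra_simps)
  qed
  have "0 \<le> f b + g' b \<and> f b + g' b \<le> c b" if b: "b \<in> arcs G" for b
  proof (cases "b = a")
    case True
    have "f a + g' a = f a + \<theta> * g a + d * (\<sigma> - \<theta> * \<sigma>)"
      by (simp add: g'_def flip: \<theta>(3))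
    moreover have "0 \<le> \<theta> * \<epsilon>"
      using \<theta>(1) g(1) by simp
    moreover have "\<theta> * \<sigma> = \<theta> * c a - \<theta> * f a" if "d = 1"
      using d that by (auto simp: right_diff_distrib)
    ultimately show ?thesis
      using conv[OF a(1)] d True \<theta>(3) by (auto simp: left_diff_distrib)
  next
    case False
    then show ?thesis
      using conv[OF b] by (simp add: g'_def)
  qed
  moreover have "excess g' z = \<theta> * \<epsilon> * (of_bool (z = w) - of_bool (z = s))" for z
  proof -
    have "excess g' z = \<theta> * (\<epsilon> * (of_bool (z = v) - of_bool (z = s))) +
        \<theta> * \<epsilon> * d * (of_bool (z = head G a) - of_bool (z = tail G a))"
      using g(3) a(1) by (simp add: g'_def excess_add excess_scale excess_single)
    also have "\<dots> = \<theta> * \<epsilon> * (of_bool (z = w) - of_bool (z = s))"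
      using d by (auto simp: algebra_simps)
    finally show ?thesis .
  qed
  ultimately show ?case
    using \<theta>(1) g(1) by (intro exI[of _ "\<theta> * \<epsilon>"] exI[of _ g']) auto
qed

lemma continuous_on_excess: "continuous_on UNIV (\<lambda>f. excess f v)"
  unfolding excess_def by (intro continuous_intros) auto

text \<open>A maximum flow exists by compactness, which covers the real capacities produced by
  truncation. If \<open>t\<close> were residually reachable, a correction would raise the value; so
  the unreachable nodes form the sink side of a tight cut.\<close>

theorem max_flow_min_cut:
  assumes st: "s \<in> verts G" "t \<in> verts G" "s \<noteq> t"
    and c: "\<And>a. a \<in> arcs G \<Longrightarrow> 0 \<le> c a"
  obtains f W where "\<forall>a\<in>arcs G. 0 \<le> f a \<and> f a \<le> c a"
    and "\<forall>v\<in>verts G - {s, t}. excess f v = 0"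
    and "W \<subseteq> verts G" "t \<in> W" "s \<notin> W"
    and "excess f t = (\<Sum>a | a \<in> arcs G \<and> head G a \<in> W \<and> tail G a \<notin> W. c a)"
proof -
  define F where "F = {f \<in> arcs G \<rightarrow>\<^sub>E {0..}.
    (\<forall>a\<in>arcs G. f a \<le> c a) \<and> (\<forall>v\<in>verts G - {s, t}. excess f v = 0)}"
  have "F = (arcs G \<rightarrow>\<^sub>E {0..}) \<inter> (\<Inter>a\<in>arcs G. {f. f a \<le> c a}) \<inter>
      (\<Inter>v\<in>verts G - {s, t}. {f. excess f v = 0})"
    by (auto simp: F_def)
  then have clF: "closed F"
    by (auto intro!: closed_Int closed_INT closed_PiE_atLeast closed_Collect_le closed_Collect_eq
        continuous_on_excess)
  \<comment> \<open>The box needs one upper bound for all coordinates; the total capacity provides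
    it.\<close>
  have bdF: "F \<subseteq> arcs G \<rightarrow>\<^sub>E {0..\<Sum>a\<in>arcs G. c a}"
  proof
    fix f assume f: "f \<in> F"
    have "f a \<le> (\<Sum>a\<in>arcs G. c a)" if "a \<in> arcs G" for a
    proof -
      have "c a \<le> (\<Sum>a\<in>arcs G. c a)"
        using that c by (intro member_le_sum) auto
      then show ?thesis
        using f that by (force simp: F_def)
    qed
    then show "f \<in> arcs G \<rightarrow>\<^sub>E {0..\<Sum>a\<in>arcs G. c a}"
      using f by (simp add: F_def PiE_iff)
  qed
  have "restrict (\<lambda>_. 0) (arcs G) \<in> F"
  proof -
    have "excess (restrict (\<lambda>_. 0) (arcs G)) v = 0" for v
      by (simp add: excess_def)
    then show ?thesis
      using c by (simp add: F_def)
  qed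
  then have "F \<noteq> {}"
    by blast
  from Greatest_attained[OF clF bdF this continuous_on_excess[of t]]
  obtain f where f: "f \<in> F" and max: "\<And>g. g \<in> F \<Longrightarrow> excess g t \<le> excess f t"
    by metis
  have fc: "\<And>a. a \<in> arcs G \<Longrightarrow> 0 \<le> f a \<and> f a \<le> c a"
    and f0: "\<And>v. v \<in> verts G - {s, t} \<Longrightarrow> excess f v = 0"
    using f by (auto simp: F_def PiE_iff)
  \<comment> \<open>Arcs entering \<open>W\<close> must be saturated and arcs leaving it empty,
    since otherwise a residual pair would lead from a reachable node into \<open>W\<close>.\<close>
  define W where "W = {v \<in> verts G. (s, v) \<notin> (residual c f)\<^sup>*}"
  have "(s, t) \<notin> (residual c f)\<^sup>*"
  proof
    assume "(s, t) \<in> (residual c f)\<^sup>*"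
    from residual_augment[OF this fc] obtain \<epsilon> g where
      g: "0 < \<epsilon>" "\<And>a. a \<in> arcs G \<Longrightarrow> 0 \<le> f a + g a \<and> f a + g a \<le> c a"
      "\<And>w. excess g w = \<epsilon> * (of_bool (w = t) - of_bool (w = s))"
      by blast
    define f' where "f' = restrict (\<lambda>a. f a + g a) (arcs G)"
    have ex: "excess f' v = excess f v + excess g v" for v
      by (subst excess_add[symmetric]) (rule excess_cong, simp add: f'_def)
    have "f' \<in> F"
      using g f0 by (auto simp: F_def ex) (auto simp: f'_def)
    with max[of f'] ex[of t] g(1,3) \<open>s \<noteq> t\<close> show False
      by simp
  qed
  then have W: "W \<subseteq> verts G" "t \<in> W" "s \<notin> W"
    using st by (auto simp: W_def)
  have sat: "f a = c a" if "a \<in> arcs G" "head G a \<in> W" "tail G a \<notin> W" for a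
  proof (rule ccontr)
    assume "f a \<noteq> c a"
    then have "(tail G a, head G a) \<in> residual c f"
      using fc[OF that(1)] that(1) by (force simp: residual_def)
    then show False
      using that by (auto simp: W_def dest: rtrancl_into_rtrancl)
  qed
  have zero: "f a = 0" if "a \<in> arcs G" "head G a \<notin> W" "tail G a \<in> W" for a
  proof (rule ccontr)
    assume "f a \<noteq> 0"
    then have "(head G a, tail G a) \<in> residual c f"
      using fc[OF that(1)] that(1) by (force simp: residual_def)
    then show False
      using that by (auto simp: W_def dest: rtrancl_into_rtrancl)
  qed
  have "excess f t = (\<Sum>a | a \<in> arcs G \<and> head G a \<in> W \<and> tail G a \<notin> W. c a)"
    using excess_sink_eq_cut[OF W f0] sat zero by simp
  then show thesis
    using that fc f0 W by blast
qed

section \<open>Decomposition of a flow into simple paths\<close>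

text \<open>Were \<open>t\<close> not reachable along arcs with positive flow, no flow would enter
  the set of unreachable nodes, and the excess at \<open>t\<close> would be at most zero. A walk
  found this way is then shortened to a simple path.\<close>

lemma support_path:
  assumes st: "s \<in> verts G" "t \<in> verts G"
    and f: "\<And>a. a \<in> arcs G \<Longrightarrow> 0 \<le> f a" "\<And>v. v \<in> verts G - {s, t} \<Longrightarrow> excess f v = 0"
    and pos: "0 < excess f t"
  obtains p where "apath s p t" "\<And>a. a \<in> set p \<Longrightarrow> 0 < f a"
proof -
  define U where "U = {v. \<exists>p. awalk s p v \<and> (\<forall>a\<in>set p. 0 < f a)}"
  have "t \<in> U"
  proof (rule ccontr)
    assume "t \<notin> U"
    have "awalk s [] s"
      using st by (simp add: awalk_simps)
    then have "s \<in> U"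
      unfolding U_def by force
    have zero: "f a = 0" if a: "a \<in> arcs G" "head G a \<in> verts G - U" "tail G a \<notin> verts G - U" for a
    proof (rule ccontr)
      assume "f a \<noteq> 0"
      then have "0 < f a"
        using f(1)[OF a(1)] by simp
      obtain p where "awalk s p (tail G a)" "\<forall>a\<in>set p. 0 < f a"
        using a by (auto simp: U_def)
      then have "awalk s (p @ [a]) (head G a)" "\<forall>b\<in>set (p @ [a]). 0 < f b"
        using a(1) \<open>0 < f a\<close> by (auto simp: awalk_simps simp del: awalk_append_iff intro!: awalk_appendI)
      then have "head G a \<in> U"
        unfolding U_def by blast
      then show False
        using a(2) by simp
    qed
    have "excess f t = - (\<Sum>a | a \<in> arcs G \<and> head G a \<notin> verts G - U \<and> tail G a \<in> verts G - U. f a)"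
      using excess_sink_eq_cut[of "verts G - U" t s f] \<open>t \<notin> U\<close> \<open>s \<in> U\<close> st f(2) zero by simp
    also have "\<dots> \<le> 0"
      using f(1) by (auto intro!: sum_nonneg)
    finally have "excess f t \<le> 0" .
    then show False
      using pos by simp
  qed
  then obtain p where p: "awalk s p t" "\<forall>a\<in>set p. 0 < f a"
    by (auto simp: U_def)
  show thesis
    using that[OF apath_awalk_to_apath[OF p(1)]] p(2) awalk_to_apath_subset[OF p(1)] by blast
qed

text \<open>Subtracting the bottleneck value along a path of the support empties at least one arc,
  so the number of arcs with positive flow decreases. Once the excess at \<open>t\<close> is not
  positive, the remaining flow is discarded; hence inequalities in the statement.\<close>

lemma flow_decomposition:
  assumes st: "s \<in> verts G" "t \<in> verts G" "s \<noteq> t"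
    and "\<And>a. a \<in> arcs G \<Longrightarrow> 0 \<le> f a" "\<And>v. v \<in> verts G - {s, t} \<Longrightarrow> excess f v = 0"
  shows "\<exists>x. (\<forall>P. 0 \<le> x P) \<and> excess f t \<le> (\<Sum>P | apath s P t. x P) \<and>
    (\<forall>a\<in>arcs G. (\<Sum>P | apath s P t \<and> a \<in> set P. x P) \<le> f a)"
  using assms(4,5)
proof (induction "card {a \<in> arcs G. 0 < f a}" arbitrary: f rule: less_induct)
  case less
  show ?case
  proof (cases "0 < excess f t")
    case False
    then show ?thesis
      using less.prems by (intro exI[of _ "\<lambda>_. 0"]) simp
  next
    case True
    obtain p where p: "apath s p t" "\<And>a. a \<in> set p \<Longrightarrow> 0 < f a"
      using support_path[OF st(1,2) less.prems True] by blast
    have "p \<noteq> []"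
      using p(1) st(3) by (auto simp: apath_simps)
    define m where "m = Min (f ` set p)"
    have m: "0 < m" "\<And>a. a \<in> set p \<Longrightarrow> m \<le> f a"
      using p(2) \<open>p \<noteq> []\<close> by (auto simp: m_def)
    obtain a\<^sub>0 where a0: "a\<^sub>0 \<in> set p" "f a\<^sub>0 = m"
    proof -
      have "m \<in> f ` set p"
        unfolding m_def using \<open>p \<noteq> []\<close> by (intro Min_in) auto
      then show thesis
        using that by blast
    qed
    have parcs: "set p \<subseteq> arcs G"
      using p(1) by (auto simp: apath_def awalk_def)
    \<comment> \<open>Subtraction is written as adding a multiple so that linearity of
      \<open>excess\<close> applies verbatim.\<close>
    define f' where "f' = (\<lambda>a. f a + (- m) * of_bool (a \<in> set p))"
    have ex: "excess f' v = excess f v - m * (of_bool (v = t) - of_bool (v = s))" for v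
      unfolding f'_def by (simp only: excess_add excess_scale excess_apath[OF p(1)])
    have "card {a \<in> arcs G. 0 < f' a} < card {a \<in> arcs G. 0 < f a}"
    proof (rule psubset_card_mono)
      have "a\<^sub>0 \<in> {a \<in> arcs G. 0 < f a} - {a \<in> arcs G. 0 < f' a}"
        using a0 m(1) parcs by (auto simp: f'_def)
      moreover have "{a \<in> arcs G. 0 < f' a} \<subseteq> {a \<in> arcs G. 0 < f a}"
        using p(2) by (auto simp: f'_def split: if_splits)
      ultimately show "{a \<in> arcs G. 0 < f' a} \<subset> {a \<in> arcs G. 0 < f a}"
        by blast
    qed simp
    moreover have "\<And>a. a \<in> arcs G \<Longrightarrow> 0 \<le> f' a"
      using m(2) less.prems(1) by (simp add: f'_def)
    moreover have "\<And>v. v \<in> verts G - {s, t} \<Longrightarrow> excess f' v = 0"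
      using less.prems(2) by (simp add: ex)
    ultimately obtain x where x: "\<And>P. 0 \<le> x P" "excess f' t \<le> (\<Sum>P | apath s P t. x P)"
      "\<And>a. a \<in> arcs G \<Longrightarrow> (\<Sum>P | apath s P t \<and> a \<in> set P. x P) \<le> f' a"
      using less.hyps[of f'] by blast
    define x' where "x' = (\<lambda>P. x P + m * of_bool (P = p))"
    have sum_x': "sum x' A = sum x A + m * of_bool (p \<in> A)" if "finite A" for A
    proof -
      have "sum x' A = sum x A + (\<Sum>P\<in>A. if P = p then m else 0)"
        unfolding x'_def by (subst sum.distrib[symmetric]) (rule sum.cong, auto)
      then show ?thesis
        using that by simp
    qed
    have fin: "finite {P. apath s P t}" "\<And>a. finite {P. apath s P t \<and> a \<in> set P}"
      using apaths_finite[of s t] by simp_all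
    have "(\<Sum>P | apath s P t \<and> a \<in> set P. x' P) \<le> f a" if "a \<in> arcs G" for a
      using x(3)[OF that] p(1) by (simp add: sum_x' fin f'_def)
    moreover have "excess f t \<le> (\<Sum>P | apath s P t. x' P)"
      using x(2) p(1) st(3) by (simp add: sum_x' fin ex)
    moreover have "\<forall>P. 0 \<le> x' P"
      using x(1) m(1) by (simp add: x'_def)
    ultimately show ?thesis
      by blast
  qed
qed

end

text \<open>Weak duality: summing balances over \<open>W\<close>, nodes other than \<open>t\<close>
  contribute nonnegatively and \<open>t\<close> at least \<open>R\<close>; what leaves
  \<open>W\<close> is dropped. It is applied to the arcs, and to the subpaths, that survive a
  scenario.\<close>

lemma sum_balance_le_cut:
  fixes y :: "'j \<Rightarrow> real" and h l :: "'j \<Rightarrow> 'v"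
  assumes fin: "finite J" "finite W" and y: "\<And>j. j \<in> J \<Longrightarrow> 0 \<le> y j" and "t \<in> W"
    and bal: "\<And>v. v \<in> W - {t} \<Longrightarrow> (\<Sum>j | j \<in> J \<and> l j = v. y j) \<le> (\<Sum>j | j \<in> J \<and> h j = v. y j)"
    and R: "R \<le> (\<Sum>j | j \<in> J \<and> h j = t. y j) - (\<Sum>j | j \<in> J \<and> l j = t. y j)"
  shows "R \<le> (\<Sum>j | j \<in> J \<and> h j \<in> W \<and> l j \<notin> W. y j)"
proof -
  let ?b = "\<lambda>v. (\<Sum>j | j \<in> J \<and> h j = v. y j) - (\<Sum>j | j \<in> J \<and> l j = v. y j)"
  have "R \<le> ?b t + (\<Sum>v\<in>W - {t}. ?b v)"
    using R sum_nonneg[of "W - {t}" ?b] bal by simp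
  also have "\<dots> = (\<Sum>v\<in>W. ?b v)"
    using sum.remove[OF fin(2) \<open>t \<in> W\<close>, of ?b] by simp
  also have "\<dots> = (\<Sum>j | j \<in> J \<and> h j \<in> W \<and> l j \<notin> W. y j) - (\<Sum>j | j \<in> J \<and> h j \<notin> W \<and> l j \<in> W. y j)"
    using fin by (rule sum_balance_eq_cut)
  also have "\<dots> \<le> (\<Sum>j | j \<in> J \<and> h j \<in> W \<and> l j \<notin> W. y j)"
    using y by (auto intro!: sum_nonneg)
  finally show ?thesis .
qed

section \<open>The three models\<close>

text \<open>In the application \<open>C\<close> is a cut with capacities \<open>w\<close>, and the
  last premise is the cut bound for the scenario that removes \<open>i\<close>.\<close>

lemma sum_min_half:
  fixes w :: "'i \<Rightarrow> real"
  assumes "finite C" "0 \<le> R" "\<And>i. i \<in> C \<Longrightarrow> 0 \<le> w i"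
    and "R \<le> (\<Sum>i\<in>C. w i)" "\<And>i. i \<in> C \<Longrightarrow> R \<le> (\<Sum>j\<in>C - {i}. w j)"
  shows "R \<le> (\<Sum>i\<in>C. min (w i) (R / 2))"
proof (cases "\<exists>i\<in>C. \<exists>j\<in>C. i \<noteq> j \<and> R / 2 \<le> w i \<and> R / 2 \<le> w j")
  case True
  then obtain i j where ij: "i \<in> C" "j \<in> C" "i \<noteq> j" "R / 2 \<le> w i" "R / 2 \<le> w j"
    by blast
  have "R = (\<Sum>i\<in>{i, j}. min (w i) (R / 2))"
    using ij by simp
  also have "\<dots> \<le> (\<Sum>i\<in>C. min (w i) (R / 2))"
    using assms ij by (intro sum_mono2) auto
  finally show ?thesis .
next
  case no_pair: False
  show ?thesis
  proof (cases "\<exists>i\<in>C. R / 2 \<le> w i")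
    case True
    then obtain i where i: "i \<in> C" "R / 2 \<le> w i"
      by blast
    \<comment> \<open>All items other than \<open>i\<close> lie below the threshold and stay
      untouched, so the truncated sum even reaches \<open>3 * R / 2\<close>.\<close>
    have "R / 2 + R \<le> R / 2 + (\<Sum>j\<in>C - {i}. w j)"
      using assms(5)[OF i(1)] by simp
    also have "(\<Sum>j\<in>C - {i}. w j) = (\<Sum>j\<in>C - {i}. min (w j) (R / 2))"
      using no_pair i by (intro sum.cong refl) (force simp: min_def)
    also have "R / 2 + \<dots> = (\<Sum>j\<in>C. min (w j) (R / 2))"
      using sum.remove[OF assms(1) i(1), of "\<lambda>j. min (w j) (R / 2)"] i(2) by simp
    finally show ?thesis
      using \<open>0 \<le> R\<close> by simp
  next
    case False
    then have "(\<Sum>i\<in>C. min (w i) (R / 2)) = (\<Sum>i\<in>C. w i)"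
      by (intro sum.cong refl) (force simp: min_def)
    then show ?thesis
      using assms(4) by simp
  qed
qed

lemma (in wf_digraph) awalk_enters:
  assumes "awalk w p v" "w \<notin> W" "v \<in> W"
  shows "\<exists>a\<in>set p. tail G a \<notin> W \<and> head G a \<in> W"
  using assms
proof (induction p arbitrary: w)
  case (Cons a p)
  show ?case
  proof (cases "head G a \<in> W")
    case True
    then show ?thesis
      using Cons.prems by (auto simp: awalk_Cons_iff)
  next
    case False
    then show ?thesis
      using Cons.IH[of "head G a"] Cons.prems by (auto simp: awalk_Cons_iff)
  qed
qed (simp add: awalk_Nil_iff)

lemma (in wf_digraph) apath_ends_conv:
  assumes "apath w p v" "p \<noteq> []"
  shows "tail G (hd p) = w" "head G (last p) = v"
proof -
  have "awalk w p v"
    using assms(1) by (rule awalkI_apath)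
  then have "cas w p v" "last (awalk_verts w p) = v"
    by (auto simp: awalk_def)
  then show "tail G (hd p) = w" "head G (last p) = v"
    using assms(2) by (simp_all add: awalk_verts_conv cas_simp)
qed

section \<open>Path sets and scenarios of a network\<close>

context network
begin

lemma finite_st_paths [simp]: "finite st_paths"
  unfolding st_paths_def by (rule apaths_finite)

lemma subpaths_apath:
  assumes "Q \<in> subpaths"
  shows "Q \<noteq> []" "apath (tail G (hd Q)) Q (head G (last Q))"
proof -
  show ne: "Q \<noteq> []"
    using assms by (simp add: subpaths_def)
  obtain ps ss where "apath s (ps @ Q @ ss) t"
    using assms by (auto simp: subpaths_def st_paths_def sublist_def)
  then have "apath (awlast s ps) Q (awlast (awlast s ps) Q)"
    by (simp add: apath_append_iff)
  then show "apath (tail G (hd Q)) Q (head G (last Q))"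
    using apath_ends_conv[OF _ ne] by metis
qed

text \<open>Makes the two ends functions of the path, as required of \<open>h\<close> and
  \<open>l\<close> in \<open>sum_balance_le_cut\<close>.\<close>

lemma in_subpaths_conv: "in_subpaths v = {Q \<in> subpaths. head G (last Q) = v}"
  and out_subpaths_conv: "out_subpaths v = {Q \<in> subpaths. tail G (hd Q) = v}"
  unfolding in_subpaths_def out_subpaths_def
  using subpaths_apath apath_ends_conv by blast+

lemma finite_subpaths [simp]: "finite subpaths"
proof (rule finite_subset)
  show "subpaths \<subseteq> (\<lambda>(_, p, _). p) ` {(u, p, v). apath u p v}"
    using subpaths_apath by (force simp: image_iff)
qed (intro finite_imageI apaths_finite_triple)

lemma subpaths_arcs: "Q \<in> subpaths \<Longrightarrow> set Q \<subseteq> arcs G"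
  using subpaths_apath(2)[of Q] by (auto simp: apath_def awalk_def)

lemma st_paths_nonempty: "P \<in> st_paths \<Longrightarrow> P \<noteq> []"
  using source_neq_sink by (auto simp: st_paths_def apath_simps)

lemma st_paths_arcs: "P \<in> st_paths \<Longrightarrow> set P \<subseteq> arcs G"
  by (auto simp: st_paths_def apath_def awalk_def)

lemma finite_interdictions: "finite (interdictions \<Gamma>)"
  by (rule finite_subset[of _ "Pow (arcs G)"]) (auto simp: interdictions_def)

lemma empty_in_interdictions: "{} \<in> interdictions \<Gamma>"
  by (simp add: interdictions_def)

lemma interdictions_1E:
  assumes "S \<in> interdictions 1"
  obtains "S = {}" | a where "a \<in> arcs G" "S = {a}"
proof -
  have "finite S" "S \<subseteq> arcs G" "card S \<le> 1"
    using assms finite_subset[OF _ finite_arcs] by (auto simp: interdictions_def)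
  then have "S = {} \<or> (\<exists>a. S = {a})"
    by (cases "card S") (auto simp: card_1_singleton_iff)
  then show thesis
    using that \<open>S \<subseteq> arcs G\<close> by auto
qed

lemma finite_interdiction_vecs: "finite (interdiction_vecs \<Gamma>)"
  by (rule finite_subset[of _ "arcs G \<rightarrow>\<^sub>E {0, 1}"]) (auto simp: interdiction_vecs_def intro!: finite_PiE)

lemma zero_in_interdiction_vecs: "restrict (\<lambda>_. 0) (arcs G) \<in> interdiction_vecs \<Gamma>"
  by (simp add: interdiction_vecs_def)

text \<open>Translates set scenarios into 0/1 vectors, so that the cut bounds of both models can
  range over the same sets \<open>S\<close>.\<close>

lemma indicator_in_interdiction_vecs:
  assumes "S \<in> interdictions \<Gamma>"
  shows "restrict (\<lambda>a. of_bool (a \<in> S)) (arcs G) \<in> interdiction_vecs \<Gamma>"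
proof -
  have "(\<Sum>a\<in>arcs G. of_bool (a \<in> S)) = real (card S)"
    using assms by (auto simp: interdictions_def Int_absorb1 of_bool_def sum.If_cases)
  then show ?thesis
    using assms by (auto simp: interdiction_vecs_def interdictions_def)
qed

text \<open>The value of a path is part of the load on its first arc, hence at most the capacity of
  that arc.\<close>

lemma path_load_bound:
  fixes x :: "'b awalk \<Rightarrow> real"
  assumes "finite I" and I: "\<And>P. P \<in> I \<Longrightarrow> P \<noteq> []" "\<And>P. P \<in> I \<Longrightarrow> set P \<subseteq> arcs G"
    and x: "x \<in> I \<rightarrow>\<^sub>E {0..}"
    and load: "\<And>a. a \<in> arcs G \<Longrightarrow> (\<Sum>P | P \<in> I \<and> a \<in> set P. x P) \<le> real (u a)"
  shows "x \<in> I \<rightarrow>\<^sub>E {0..(\<Sum>a\<in>arcs G. real (u a))}"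
proof -
  have "x P \<le> (\<Sum>a\<in>arcs G. real (u a))" if P: "P \<in> I" for P
  proof -
    have hd: "hd P \<in> set P" "hd P \<in> arcs G"
      using I[OF P] by auto
    have "x P \<le> (\<Sum>Q | Q \<in> I \<and> hd P \<in> set Q. x Q)"
      using P hd assms(1) x by (intro member_le_sum) (auto simp: PiE_iff)
    also have "\<dots> \<le> real (u (hd P))"
      using hd(2) by (rule load)
    also have "\<dots> \<le> (\<Sum>a\<in>arcs G. real (u a))"
      using hd(2) by (intro member_le_sum) simp_all
    finally show ?thesis .
  qed
  then show ?thesis
    using x by (simp add: PiE_iff)
qed

section \<open>Attainment of the three optimal values\<close>

text \<open>Maximality is recorded here because \<open>pm_opt\<close> gets bounded from below by a
  constructed solution; for the other two models a feasible point attaining the optimum is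
  enough.\<close>

lemma pm_attained:
  obtains x where "x \<in> pm_feasible" "pm_opt \<Gamma> = pm_objective \<Gamma> x"
    "\<And>y. y \<in> pm_feasible \<Longrightarrow> pm_objective \<Gamma> y \<le> pm_objective \<Gamma> x"
proof -
  have "pm_feasible = (st_paths \<rightarrow>\<^sub>E {0..}) \<inter>
      (\<Inter>a\<in>arcs G. {x. (\<Sum>P | P \<in> st_paths \<and> a \<in> set P. x P) \<le> real (u a)})"
    by (auto simp: pm_feasible_def)
  then have 1: "closed pm_feasible"
    by (auto intro!: closed_Int closed_INT closed_PiE_atLeast closed_Collect_le continuous_on_sum)
  have 2: "pm_feasible \<subseteq> st_paths \<rightarrow>\<^sub>E {0..(\<Sum>a\<in>arcs G. real (u a))}"
    by (intro subsetI path_load_bound finite_st_paths st_paths_nonempty st_paths_arcs)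
      (simp_all add: pm_feasible_def)
  have "restrict (\<lambda>_. 0) st_paths \<in> pm_feasible"
    by (simp add: pm_feasible_def)
  then have 3: "pm_feasible \<noteq> {}"
    by blast
  have 4: "continuous_on UNIV (pm_objective \<Gamma>)"
    unfolding pm_objective_def using empty_in_interdictions
    by (intro continuous_on_diff continuous_on_Max_image continuous_on_sum finite_interdictions) auto
  show thesis
    using Greatest_attained[OF 1 2 3 4] that unfolding pm_opt_def by metis
qed

lemma am_attained:
  obtains x where "x \<in> am_feasible \<Gamma>" "am_opt \<Gamma> = am_objective \<Gamma> x"
proof -
  have "am_feasible \<Gamma> = (arcs G \<rightarrow>\<^sub>E {0..}) \<inter>
      (\<Inter>v\<in>verts G - {s, t}. \<Inter>z\<in>interdiction_vecs \<Gamma>.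
        {x. 0 \<le> (\<Sum>a\<in>in_arcs G v. (1 - z a) * x a) - (\<Sum>a\<in>out_arcs G v. x a)}) \<inter>
      (\<Inter>a\<in>arcs G. {x. x a \<le> real (u a)})"
    by (auto simp: am_feasible_def)
  then have 1: "closed (am_feasible \<Gamma>)"
    by (auto intro!: closed_Int closed_INT closed_PiE_atLeast closed_Collect_le continuous_on_sum
        continuous_on_diff continuous_on_mult)
  have 2: "am_feasible \<Gamma> \<subseteq> arcs G \<rightarrow>\<^sub>E {0..(\<Sum>a\<in>arcs G. real (u a))}"
  proof
    fix x assume x: "x \<in> am_feasible \<Gamma>"
    have "x a \<le> (\<Sum>a\<in>arcs G. real (u a))" if a: "a \<in> arcs G" for a
    proof -
      have "x a \<le> real (u a)"
        using x a by (simp add: am_feasible_def)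
      also have "\<dots> \<le> (\<Sum>a\<in>arcs G. real (u a))"
        using a by (intro member_le_sum) simp_all
      finally show ?thesis .
    qed
    then show "x \<in> arcs G \<rightarrow>\<^sub>E {0..(\<Sum>a\<in>arcs G. real (u a))}"
      using x by (simp add: am_feasible_def PiE_iff)
  qed
  have "restrict (\<lambda>_. 0) (arcs G) \<in> am_feasible \<Gamma>"
    by (simp add: am_feasible_def)
  then have 3: "am_feasible \<Gamma> \<noteq> {}"
    by blast
  have 4: "continuous_on UNIV (am_objective \<Gamma>)"
    unfolding am_objective_def using zero_in_interdiction_vecs
    by (intro continuous_on_diff continuous_on_Max_image continuous_on_sum continuous_on_mult
        finite_interdiction_vecs) auto
  show thesis
    using Greatest_attained[OF 1 2 3 4] that unfolding am_opt_def by metis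
qed

lemma gm_attained:
  obtains x where "x \<in> gm_feasible \<Gamma>" "gm_opt \<Gamma> = gm_objective \<Gamma> x"
proof -
  have "gm_feasible \<Gamma> = (subpaths \<rightarrow>\<^sub>E {0..}) \<inter>
      (\<Inter>v\<in>verts G - {s, t}. \<Inter>S\<in>interdictions \<Gamma>.
        {x. (\<Sum>P\<in>out_subpaths v. x P) \<le>
          (\<Sum>P\<in>in_subpaths v. x P) - (\<Sum>P | P \<in> in_subpaths v \<and> set P \<inter> S \<noteq> {}. x P)}) \<inter>
      (\<Inter>a\<in>arcs G. {x. (\<Sum>P | P \<in> subpaths \<and> a \<in> set P. x P) \<le> real (u a)})"
    by (auto simp: gm_feasible_def)
  then have 1: "closed (gm_feasible \<Gamma>)"
    by (auto intro!: closed_Int closed_INT closed_PiE_atLeast closed_Collect_le continuous_on_sum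
        continuous_on_diff)
  have 2: "gm_feasible \<Gamma> \<subseteq> subpaths \<rightarrow>\<^sub>E {0..(\<Sum>a\<in>arcs G. real (u a))}"
    by (intro subsetI path_load_bound finite_subpaths subpaths_apath(1) subpaths_arcs)
      (simp_all add: gm_feasible_def)
  have "restrict (\<lambda>_. 0) subpaths \<in> gm_feasible \<Gamma>"
    by (simp add: gm_feasible_def in_subpaths_conv out_subpaths_conv)
  then have 3: "gm_feasible \<Gamma> \<noteq> {}"
    by blast
  have 4: "continuous_on UNIV (gm_objective \<Gamma>)"
    unfolding gm_objective_def using empty_in_interdictions
    by (intro continuous_on_diff continuous_on_Max_image continuous_on_sum finite_interdictions) auto
  show thesis
    using Greatest_attained[OF 1 2 3 4] that unfolding gm_opt_def by metis
qed

section \<open>Cut bounds for the arc model and the general model\<close>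

definition cut_arcs :: "'b set \<Rightarrow> 'a set \<Rightarrow> 'b set" where
  "cut_arcs S W = {a \<in> arcs G - S. head G a \<in> W \<and> tail G a \<notin> W}"

lemma finite_cut_arcs [simp]: "finite (cut_arcs S W)"
  by (simp add: cut_arcs_def)

text \<open>For the indicator \<open>z\<close> of \<open>S\<close>, the conservation constraint
  counts only surviving inflow. Shrinking the outflow to surviving arcs keeps it valid, so
  \<open>x\<close> satisfies the balance inequalities on the arcs outside \<open>S\<close>.\<close>

lemma am_cut_bound:
  assumes x: "x \<in> am_feasible \<Gamma>" and S: "S \<in> interdictions \<Gamma>"
    and W: "W \<subseteq> verts G" "t \<in> W" "s \<notin> W"
  shows "am_objective \<Gamma> x \<le> (\<Sum>a\<in>cut_arcs S W. real (u a))"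
proof -
  define z where "z = restrict (\<lambda>a. of_bool (a \<in> S) :: real) (arcs G)"
  have z: "z \<in> interdiction_vecs \<Gamma>"
    unfolding z_def using S by (rule indicator_in_interdiction_vecs)
  have x0: "\<And>a. a \<in> arcs G \<Longrightarrow> 0 \<le> x a" and xu: "\<And>a. a \<in> arcs G \<Longrightarrow> x a \<le> real (u a)"
    using x by (auto simp: am_feasible_def PiE_iff)
  have into: "(\<Sum>a\<in>in_arcs G v. (1 - z a) * x a) = (\<Sum>a | a \<in> arcs G - S \<and> head G a = v. x a)" for v
    by (rule sum.mono_neutral_cong_right) (auto simp: z_def)
  have out: "(\<Sum>a | a \<in> arcs G - S \<and> tail G a = v. x a) \<le> (\<Sum>a\<in>out_arcs G v. x a)" for v
    using x0 by (intro sum_mono2) auto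
  have "am_objective \<Gamma> x \<le> (\<Sum>a | a \<in> arcs G - S \<and> head G a \<in> W \<and> tail G a \<notin> W. x a)"
  proof (rule sum_balance_le_cut)
    show "finite W"
      using W(1) finite_verts by (rule finite_subset)
    show "(\<Sum>a | a \<in> arcs G - S \<and> tail G a = v. x a) \<le> (\<Sum>a | a \<in> arcs G - S \<and> head G a = v. x a)"
      if "v \<in> W - {t}" for v
    proof -
      have "v \<in> verts G - {s, t}"
        using that W by auto
      then have "(\<Sum>a\<in>in_arcs G v. (1 - z a) * x a) - (\<Sum>a\<in>out_arcs G v. x a) \<ge> 0"
        using x z unfolding am_feasible_def by blast
      then show ?thesis
        using into[of v] out[of v] by simp
    qed
    \<comment> \<open>The worst-case loss is at least the loss under this \<open>z\<close>, so the
      objective is at most the surviving inflow at \<open>t\<close>.\<close>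
    have "(\<Sum>a\<in>in_arcs G t. z a * x a) \<le> Max ((\<lambda>z. \<Sum>a\<in>in_arcs G t. z a * x a) ` interdiction_vecs \<Gamma>)"
      using z finite_interdiction_vecs by (intro Max_ge) auto
    then have "am_objective \<Gamma> x \<le> (\<Sum>a\<in>in_arcs G t. (1 - z a) * x a)"
      by (simp add: am_objective_def left_diff_distrib sum_subtractf)
    moreover have "(\<Sum>a | a \<in> arcs G - S \<and> tail G a = t. x a) \<le> 0"
      using out[of t] by (simp add: no_arc_out_of_sink)
    ultimately show "am_objective \<Gamma> x \<le> (\<Sum>a | a \<in> arcs G - S \<and> head G a = t. x a) -
        (\<Sum>a | a \<in> arcs G - S \<and> tail G a = t. x a)"
      using into[of t] by simp
  qed (use W x0 in auto)
  also have "\<dots> = (\<Sum>a\<in>cut_arcs S W. x a)"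
    by (simp add: cut_arcs_def)
  also have "\<dots> \<le> (\<Sum>a\<in>cut_arcs S W. real (u a))"
    using xu by (intro sum_mono) (simp add: cut_arcs_def)
  finally show ?thesis .
qed

text \<open>Surviving subpaths act as single arcs from their first to their last node. The cut bound
  then concerns the paths in \<open>K\<close>, and their values are charged to the cut arcs they
  use.\<close>

lemma gm_cut_bound:
  assumes x: "x \<in> gm_feasible \<Gamma>" and S: "S \<in> interdictions \<Gamma>"
    and W: "W \<subseteq> verts G" "t \<in> W" "s \<notin> W"
  shows "gm_objective \<Gamma> x \<le> (\<Sum>a\<in>cut_arcs S W. real (u a))"
proof -
  define J where "J = {Q \<in> subpaths. set Q \<inter> S = {}}"
  define K where "K = {Q. Q \<in> J \<and> head G (last Q) \<in> W \<and> tail G (hd Q) \<notin> W}"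
  have finJ: "finite J" and finK: "finite K"
    by (simp_all add: J_def K_def)
  have x0: "\<And>Q. Q \<in> subpaths \<Longrightarrow> 0 \<le> x Q"
    using x by (auto simp: gm_feasible_def PiE_iff)
  have into: "(\<Sum>Q\<in>in_subpaths v. x Q) - (\<Sum>Q | Q \<in> in_subpaths v \<and> set Q \<inter> S \<noteq> {}. x Q) =
      (\<Sum>Q | Q \<in> J \<and> head G (last Q) = v. x Q)" for v
  proof -
    have "(\<Sum>Q\<in>in_subpaths v. x Q) - (\<Sum>Q | Q \<in> in_subpaths v \<and> set Q \<inter> S \<noteq> {}. x Q) =
        (\<Sum>Q\<in>in_subpaths v - {Q. Q \<in> in_subpaths v \<and> set Q \<inter> S \<noteq> {}}. x Q)"
      by (subst sum_diff) (auto simp: in_subpaths_conv)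
    also have "in_subpaths v - {Q. Q \<in> in_subpaths v \<and> set Q \<inter> S \<noteq> {}} =
        {Q. Q \<in> J \<and> head G (last Q) = v}"
      by (auto simp: J_def in_subpaths_conv)
    finally show ?thesis .
  qed
  have out: "(\<Sum>Q | Q \<in> J \<and> tail G (hd Q) = v. x Q) \<le> (\<Sum>Q\<in>out_subpaths v. x Q)" for v
    using x0 by (intro sum_mono2) (auto simp: J_def out_subpaths_conv)
  have "gm_objective \<Gamma> x \<le> (\<Sum>Q | Q \<in> J \<and> head G (last Q) \<in> W \<and> tail G (hd Q) \<notin> W. x Q)"
  proof (rule sum_balance_le_cut)
    show "finite W"
      using W(1) finite_verts by (rule finite_subset)
    show "(\<Sum>Q | Q \<in> J \<and> tail G (hd Q) = v. x Q) \<le> (\<Sum>Q | Q \<in> J \<and> head G (last Q) = v. x Q)"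
      if "v \<in> W - {t}" for v
    proof -
      have "v \<in> verts G - {s, t}"
        using that W by auto
      then have "(\<Sum>Q\<in>in_subpaths v. x Q) - (\<Sum>Q | Q \<in> in_subpaths v \<and> set Q \<inter> S \<noteq> {}. x Q)
          \<ge> (\<Sum>Q\<in>out_subpaths v. x Q)"
        using x S unfolding gm_feasible_def by blast
      then show ?thesis
        using into[of v] out[of v] by simp
    qed
    have "(\<Sum>Q | Q \<in> in_subpaths t \<and> set Q \<inter> S \<noteq> {}. x Q) \<le>
        Max ((\<lambda>S. \<Sum>Q | Q \<in> in_subpaths t \<and> set Q \<inter> S \<noteq> {}. x Q) ` interdictions \<Gamma>)"
      using S finite_interdictions by (intro Max_ge) auto
    then have "gm_objective \<Gamma> x \<le> (\<Sum>Q | Q \<in> J \<and> head G (last Q) = t. x Q)"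
      unfolding gm_objective_def into[symmetric] by simp
    moreover have "out_subpaths t = {}"
    proof -
      have "tail G (hd Q) \<noteq> t" if "Q \<in> subpaths" for Q
      proof -
        have "hd Q \<in> arcs G"
          using subpaths_arcs[OF that] subpaths_apath(1)[OF that] by auto
        then show ?thesis
          using no_arc_out_of_sink by (auto simp: out_arcs_def)
      qed
      then show ?thesis
        by (auto simp: out_subpaths_conv)
    qed
    ultimately show "gm_objective \<Gamma> x \<le> (\<Sum>Q | Q \<in> J \<and> head G (last Q) = t. x Q) -
        (\<Sum>Q | Q \<in> J \<and> tail G (hd Q) = t. x Q)"
      using out[of t] by simp
  qed (use W x0 finJ in \<open>auto simp: J_def\<close>)
  also have "\<dots> = (\<Sum>Q\<in>K. x Q)"
    by (simp add: K_def)
  \<comment> \<open>Each path of \<open>K\<close> starts outside \<open>W\<close> and ends inside,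
    so it uses at least one entering arc, which survives because the path avoids \<open>S\<close>.
    Several crossings only increase the right-hand side.\<close>
  also have "\<dots> \<le> (\<Sum>Q\<in>K. \<Sum>a | a \<in> cut_arcs S W \<and> a \<in> set Q. x Q)"
  proof (rule sum_mono)
    fix Q assume Q: "Q \<in> K"
    then have sub: "Q \<in> subpaths" and disj: "set Q \<inter> S = {}"
      by (auto simp: J_def K_def)
    obtain a where a: "a \<in> set Q" "tail G a \<notin> W" "head G a \<in> W"
      using awalk_enters[OF awalkI_apath[OF subpaths_apath(2)[OF sub]], of W] Q
      by (auto simp: K_def)
    then have "a \<in> cut_arcs S W"
      using subpaths_arcs[OF sub] disj by (auto simp: cut_arcs_def)
    then show "x Q \<le> (\<Sum>a | a \<in> cut_arcs S W \<and> a \<in> set Q. x Q)"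
      using a(1) x0[OF sub] by (intro member_le_sum[of a]) auto
  qed
  \<comment> \<open>Double counting: after the exchange the capacity constraint applies arc by
    arc.\<close>
  also have "\<dots> = (\<Sum>a\<in>cut_arcs S W. \<Sum>Q | Q \<in> K \<and> a \<in> set Q. x Q)"
    using finK by (intro sum.swap_restrict) simp_all
  also have "\<dots> \<le> (\<Sum>a\<in>cut_arcs S W. real (u a))"
  proof (rule sum_mono)
    fix a assume a: "a \<in> cut_arcs S W"
    have "(\<Sum>Q | Q \<in> K \<and> a \<in> set Q. x Q) \<le> (\<Sum>Q | Q \<in> subpaths \<and> a \<in> set Q. x Q)"
      using x0 by (intro sum_mono2) (auto simp: J_def K_def)
    also have "\<dots> \<le> real (u a)"
      using x a by (simp add: gm_feasible_def cut_arcs_def)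
    finally show "(\<Sum>Q | Q \<in> K \<and> a \<in> set Q. x Q) \<le> real (u a)" .
  qed
  finally show ?thesis .
qed

text \<open>The common last stage for both models, which enter only through their cut
  bounds.\<close>

lemma pm_opt_ge_half_cut:
  assumes "\<And>S W. \<lbrakk>S \<in> interdictions 1; W \<subseteq> verts G; t \<in> W; s \<notin> W\<rbrakk>
    \<Longrightarrow> R\<^sub>0 \<le> (\<Sum>a\<in>cut_arcs S W. real (u a))"
  shows "R\<^sub>0 \<le> 2 * pm_opt 1"
proof -
  \<comment> \<open>Clamping at zero keeps the truncated capacities nonnegative; the cut bounds
    survive since sums of capacities are nonnegative.\<close>
  define R where "R = max R\<^sub>0 0"
  have "0 \<le> R"
    by (simp add: R_def)
  have cut: "R \<le> (\<Sum>a\<in>cut_arcs S W. real (u a))"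
    if "S \<in> interdictions 1" "W \<subseteq> verts G" "t \<in> W" "s \<notin> W" for S W
    using assms[OF that] by (simp add: R_def sum_nonneg)
  define c where "c a = min (real (u a)) (R / 2)" for a
  have c0: "\<And>a. a \<in> arcs G \<Longrightarrow> 0 \<le> c a"
    using \<open>0 \<le> R\<close> by (simp add: c_def)
  obtain f W where f: "\<forall>a\<in>arcs G. 0 \<le> f a \<and> f a \<le> c a"
      "\<forall>v\<in>verts G - {s, t}. excess f v = 0"
    and W: "W \<subseteq> verts G" "t \<in> W" "s \<notin> W"
    and val: "excess f t = (\<Sum>a | a \<in> arcs G \<and> head G a \<in> W \<and> tail G a \<notin> W. c a)"
    by (rule max_flow_min_cut[OF source_in_verts sink_in_verts source_neq_sink c0])
  have f': "\<And>a. a \<in> arcs G \<Longrightarrow> 0 \<le> f a" "\<And>v. v \<in> verts G - {s, t} \<Longrightarrow> excess f v = 0"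
    using f by blast+
  have "R \<le> excess f t"
  proof -
    have "R \<le> (\<Sum>a\<in>cut_arcs {} W. min (real (u a)) (R / 2))"
    proof (rule sum_min_half)
      show "R \<le> (\<Sum>a\<in>cut_arcs {} W. real (u a))"
        using empty_in_interdictions W by (rule cut)
      show "R \<le> (\<Sum>b\<in>cut_arcs {} W - {a}. real (u b))" if "a \<in> cut_arcs {} W" for a
      proof -
        \<comment> \<open>Deleting one arc of the cut is itself a scenario for budget 1, which
          supplies the last premise of \<open>sum_min_half\<close>.\<close>
        have "{a} \<in> interdictions 1" "cut_arcs {} W - {a} = cut_arcs {a} W"
          using that by (auto simp: interdictions_def cut_arcs_def)
        then show ?thesis
          using cut[of "{a}" W] W by simp
      qed
    qed (use \<open>0 \<le> R\<close> in auto)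
    then show ?thesis
      by (simp add: val c_def cut_arcs_def)
  qed
  moreover have "\<exists>x. (\<forall>P. 0 \<le> x P) \<and> excess f t \<le> (\<Sum>P | apath s P t. x P) \<and>
      (\<forall>a\<in>arcs G. (\<Sum>P | apath s P t \<and> a \<in> set P. x P) \<le> f a)"
    using f' by (intro flow_decomposition source_in_verts sink_in_verts source_neq_sink)
  then obtain x where x: "\<forall>P. 0 \<le> x P" "excess f t \<le> (\<Sum>P | apath s P t. x P)"
    "\<forall>a\<in>arcs G. (\<Sum>P | apath s P t \<and> a \<in> set P. x P) \<le> f a"
    by (elim exE conjE)
  ultimately have val_x: "R \<le> (\<Sum>P\<in>st_paths. x P)"
    by (simp add: st_paths_def)
  have load: "(\<Sum>P | P \<in> st_paths \<and> a \<in> set P. x P) \<le> c a" if "a \<in> arcs G" for a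
    using x(3) f(1) that by (force simp: st_paths_def)
  define y where "y = restrict x st_paths"
  have "y \<in> pm_feasible"
    using x(1) load by (auto simp: pm_feasible_def y_def c_def)
  \<comment> \<open>With budget 1 a scenario destroys either nothing or the load of a single arc,
    which truncation keeps at most \<open>R / 2\<close>.\<close>
  have "Max ((\<lambda>S. \<Sum>P | P \<in> st_paths \<and> set P \<inter> S \<noteq> {}. y P) ` interdictions 1) \<le> R / 2"
  proof (rule Max.boundedI)
    fix r assume "r \<in> (\<lambda>S. \<Sum>P | P \<in> st_paths \<and> set P \<inter> S \<noteq> {}. y P) ` interdictions 1"
    then obtain S where S: "S \<in> interdictions 1" "r = (\<Sum>P | P \<in> st_paths \<and> set P \<inter> S \<noteq> {}. y P)"
      by blast
    from S(1) show "r \<le> R / 2"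
    proof (cases rule: interdictions_1E)
      case 1
      then show ?thesis
        using S(2) \<open>0 \<le> R\<close> by simp
    next
      case (2 a)
      then show ?thesis
        using S(2) load[of a] by (simp add: y_def c_def)
    qed
  qed (use finite_interdictions empty_in_interdictions in auto)
  then have "R / 2 \<le> pm_objective 1 y"
    using val_x by (simp add: pm_objective_def y_def)
  also have "\<dots> \<le> pm_opt 1"
    using pm_attained \<open>y \<in> pm_feasible\<close> by metis
  finally show ?thesis
    by (simp add: R_def)
qed

end

theorem theorem3p11:
  fixes G :: "('a, 'b) pre_digraph" and s t :: 'a and u :: "'b \<Rightarrow> nat" and \<Gamma> :: nat
  assumes "network G s t u"
    and "\<nexists>C. pre_digraph.cycle G C"
    and "\<Gamma> = 1"
  shows "network.gm_opt G s t u \<Gamma> \<le> 2 * network.pm_opt G s t u \<Gamma> \<and>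
         network.am_opt G s t u \<Gamma> \<le> 2 * network.pm_opt G s t u \<Gamma>"
proof -
  interpret network G s t u
    by fact
  obtain x where x: "x \<in> gm_feasible 1" "gm_opt 1 = gm_objective 1 x"
    by (rule gm_attained)
  obtain y where y: "y \<in> am_feasible 1" "am_opt 1 = am_objective 1 y"
    by (rule am_attained)
  \<comment> \<open>\<open>R\<^sub>0\<close> is the objective value of an optimal solution, so the
    cut bound of the model is exactly the premise.\<close>
  have "gm_opt 1 \<le> 2 * pm_opt 1"
    unfolding x(2) using gm_cut_bound[OF x(1)] by (rule pm_opt_ge_half_cut)
  moreover have "am_opt 1 \<le> 2 * pm_opt 1"
    unfolding y(2) using am_cut_bound[OF y(1)] by (rule pm_opt_ge_half_cut)
  ultimately show ?thesis
    using \<open>\<Gamma> = 1\<close> by simp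
qed

end
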